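(* The price of anarchy, with respect to liquid welfare, of coarse correlated equilibria in discriminatory price multi-unit auctions with budgets is at most $$\frac{2+\mathcal W_0(-e^{-2})}{1+\mathcal W_0(-e^{-2})}\approx2.188.$$ That is, for every such instance $I$ and every coarse correlated equilibrium $A$ of $I$, $\mathrm{OPT}(I)\le\frac{2+\mathcal W_0(-e^{-2})}{1+\mathcal W_0(-e^{-2})}\,\mathrm{LW}(I,A)$.
   Context: $\mathcal W_0$ is the principal real branch of the Lambert function: $\mathcal W_0(-e^{-2})$ is the unique $w\in[-1,0)$ with $we^w=-e^{-2}$. Discriminatory price auction: bidders $N=[n]$, $n\ge2$, and $k\ge1$ identical units. Bidder $i$'s action is $a_i=(b_i,q_i)\in\mathcal A_i=\mathbb R_{\ge0}\times\{0,1,\dots,k\}$: a per-unit bid and a demanded quantity; $\mathcal A=\prod_i\mathcal A_i$. The marginal bids form the multiset containing $q_i$ copies of $b_i$ for each $i$. The $k$ units go to the $k$ highest marginal bids, ties resolved by a fixed deterministic rule (if fewer than $k$ marginal bids are submitted, all of them win and the missing entries are treated as bids of $0$); $X_i(a)\in\{0,\dots,k\}$ is the number of units won by $i$, who pays $P_i(a)=b_iX_i(a)$. Bidder $i$ has a concave valuation $v_i:\{0,1,\dots,k\}\to\mathbb R_{\ge0}$ with $v_i(0)=0$ and a budget $B_i\in(0,\infty]$. Utility: $u_i(a)=v_i(X_i(a))-P_i(a)$. Feasible allocations: $\mathcal X=\{x\in\{0,\dots,k\}^n:\sum_ix_i\le k\}$. $\Delta(S)$ denotes probability distributions on $S$.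 For $A\in\Delta(\mathcal A)$ let $A_{-i}$ be the marginal on the others' actions, and let $\mathcal C_i(A_{-i})$ be the set of $A_i'\in\Delta(\mathcal A_i)$ with $\mathbb E_{a_i'\sim A_i',a_{-i}\sim A_{-i}}[P_i(a_i',a_{-i})]\le B_i$ (independent draws). $A\in\Delta(\mathcal A)$ is a coarse correlated equilibrium if for all $i$: $\mathbb E_{a\sim A}[P_i(a)]\le B_i$, and $\mathbb E_{a\sim A}[u_i(a)]\ge\mathbb E_{a_i'\sim A_i',a_{-i}\sim A_{-i}}[u_i(a_i',a_{-i})]$ for all $A_i'\in\mathcal C_i(A_{-i})$. $\mathrm{LW}(I,A)=\sum_i\min\{\mathbb E_{a\sim A}[v_i(X_i(a))],B_i\}$ and $\mathrm{OPT}(I)=\max_{\chi\in\Delta(\mathcal X)}\sum_i\min\{\mathbb E_{x\sim\chi}[v_i(x_i)],B_i\}$. The price of anarchy is the supremum of $\mathrm{OPT}(I)/\mathrm{LW}(I,A)$ over instances $I$ and equilibria $A$. *)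

theory Defs
  imports "HOL-Probability.Probability"
begin

text \<open>Principal real branch of the Lambert function, meaningful for arguments at least \<open>- exp (-1)\<close>.\<close>

definition lambert_W0 :: "real \<Rightarrow> real" where
  "lambert_W0 x = (THE w. - 1 \<le> w \<and> w * exp w = x)"

lemma lambert_W0_unique:
  fixes v w :: real
  assumes "- 1 \<le> v" "- 1 \<le> w" "v * exp v = w * exp w"
  shows "v = w"
proof -
  have *: "x * exp x < y * exp y" if "- 1 \<le> x" "x < y" for x y :: real
  proof (rule DERIV_pos_imp_increasing_open[OF that(2)])
    fix z :: real
    assume "x < z" "z < y"
    then have "0 < (1 + z) * exp z"
      using that by simp
    moreover have "((\<lambda>x. x * exp x) has_real_derivative (1 + z) * exp z) (at z)"
      by (auto intro!: derivative_eq_intros simp: algebra_simps)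
    ultimately show "\<exists>d. ((\<lambda>x. x * exp x) has_real_derivative d) (at z) \<and> 0 < d"
      by blast
  qed (auto intro!: continuous_intros)
  show ?thesis
    using *[of v w] *[of w v] assms by (cases v w rule: linorder_cases) auto
qed

lemma lambert_W0_minus_exp_minus_2:
  "- 1 \<le> lambert_W0 (- exp (- 2))" "lambert_W0 (- exp (- 2)) < 0"
  "lambert_W0 (- exp (- 2)) * exp (lambert_W0 (- exp (- 2))) = - exp (- 2)"
proof -
  have "\<exists>w\<ge>- 1. w \<le> 0 \<and> w * exp w = - exp (- 2 :: real)"
    by (rule IVT') (auto intro!: continuous_intros)
  then obtain w :: real where w: "- 1 \<le> w" "w * exp w = - exp (- 2)"
    by blast
  have "lambert_W0 (- exp (- 2)) = w"
    unfolding lambert_W0_def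
    by (rule the_equality) (use w lambert_W0_unique in auto)
  moreover have "w < 0"
    using w(2) by (smt (verit) exp_gt_zero mult_nonneg_nonneg)
  ultimately show "- 1 \<le> lambert_W0 (- exp (- 2))" "lambert_W0 (- exp (- 2)) < 0"
    "lambert_W0 (- exp (- 2)) * exp (lambert_W0 (- exp (- 2))) = - exp (- 2)"
    using w by simp_all
qed

type_synonym action = "real \<times> nat"
type_synonym profile = "nat \<Rightarrow> action"

text \<open>The component \<open>winners\<close> is the tie-breaking rule: it selects, for every action profile,
  which marginal bids win. A pair \<open>(i, l)\<close> stands for the \<open>l\<close>-th copy of bidder \<open>i\<close>'s bid.\<close>

record auction =
  bidders :: nat
  units :: nat
  val :: "nat \<Rightarrow> nat \<Rightarrow> real"
  budget :: "nat \<Rightarrow> ennreal"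
  winners :: "profile \<Rightarrow> (nat \<times> nat) set"

definition action_space :: "auction \<Rightarrow> action measure" where
  "action_space I = restrict_space borel {0..} \<Otimes>\<^sub>M count_space {0..units I}"

definition profile_space :: "auction \<Rightarrow> nat set \<Rightarrow> profile measure" where
  "profile_space I J = (\<Pi>\<^sub>M i\<in>J. action_space I)"

definition marginal_bids :: "auction \<Rightarrow> profile \<Rightarrow> (nat \<times> nat) set" where
  "marginal_bids I a = (SIGMA i:{1..bidders I}. {1..snd (a i)})"

definition highest_bids :: "auction \<Rightarrow> profile \<Rightarrow> (nat \<times> nat) set \<Rightarrow> bool" where
  "highest_bids I a W \<longleftrightarrow>
     W \<subseteq> marginal_bids I a \<and> card W = min (units I) (card (marginal_bids I a)) \<and>
     (\<forall>(i, l)\<in>W. \<forall>(j, m)\<in>marginal_bids I a - W. fst (a j) \<le> fst (a i))"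

definition units_won :: "auction \<Rightarrow> nat \<Rightarrow> profile \<Rightarrow> nat" where
  "units_won I i a = card {l. (i, l) \<in> winners I a}"

definition payment :: "auction \<Rightarrow> nat \<Rightarrow> profile \<Rightarrow> real" where
  "payment I i a = fst (a i) * real (units_won I i a)"

definition utility :: "auction \<Rightarrow> nat \<Rightarrow> profile \<Rightarrow> real" where
  "utility I i a = val I i (units_won I i a) - payment I i a"

definition concave_upto :: "nat \<Rightarrow> (nat \<Rightarrow> real) \<Rightarrow> bool" where
  "concave_upto k f \<longleftrightarrow> (\<forall>j. j + 2 \<le> k \<longrightarrow> f (j + 2) - f (j + 1) \<le> f (j + 1) - f j)"

text \<open>An arbitrary deterministic tie-breaking rule is allowed. Measurability only ensures that the
  expectations below make sense.\<close>

definition discriminatory_auction :: "auction \<Rightarrow> bool" where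
  "discriminatory_auction I \<longleftrightarrow>
     2 \<le> bidders I \<and> 1 \<le> units I \<and>
     (\<forall>i\<in>{1..bidders I}.
        val I i 0 = 0 \<and> (\<forall>j\<le>units I. 0 \<le> val I i j) \<and> concave_upto (units I) (val I i) \<and>
        0 < budget I i) \<and>
     (\<forall>a\<in>space (profile_space I {1..bidders I}). highest_bids I a (winners I a)) \<and>
     (\<forall>i\<in>{1..bidders I}.
        units_won I i \<in> profile_space I {1..bidders I} \<rightarrow>\<^sub>M count_space UNIV)"

text \<open>Bids are unbounded, so payments may have infinite expectation and the Bochner integral, which
  is 0 on non-integrable functions, is not adequate. Utilities are bounded above, so the difference
  below is never \<open>\<infinity> - \<infinity>\<close> for them.\<close>

definition ext_expectation :: "'a measure \<Rightarrow> ('a \<Rightarrow> real) \<Rightarrow> ereal" where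
  "ext_expectation M f =
     enn2ereal (\<integral>\<^sup>+x. ennreal (f x) \<partial>M) - enn2ereal (\<integral>\<^sup>+x. ennreal (- f x) \<partial>M)"

definition marginal_others :: "auction \<Rightarrow> nat \<Rightarrow> profile measure \<Rightarrow> profile measure" where
  "marginal_others I i A =
     distr A (profile_space I ({1..bidders I} - {i})) (\<lambda>a. restrict a ({1..bidders I} - {i}))"

text \<open>Law of the profile when bidder \<open>i\<close> draws from \<open>A'\<close> and, independently, the others draw
  from \<open>D\<close>.\<close>

definition deviation ::
  "auction \<Rightarrow> nat \<Rightarrow> action measure \<Rightarrow> profile measure \<Rightarrow> profile measure" where
  "deviation I i A' D =
     distr (A' \<Otimes>\<^sub>M D) (profile_space I {1..bidders I}) (\<lambda>(a', a). a(i := a'))"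

definition budget_feasible :: "auction \<Rightarrow> nat \<Rightarrow> profile measure \<Rightarrow> action measure set" where
  "budget_feasible I i D =
     {A' \<in> space (prob_algebra (action_space I)).
        (\<integral>\<^sup>+a. ennreal (payment I i a) \<partial>deviation I i A' D) \<le> budget I i}"

definition coarse_correlated_equilibrium :: "auction \<Rightarrow> profile measure \<Rightarrow> bool" where
  "coarse_correlated_equilibrium I A \<longleftrightarrow>
     A \<in> space (prob_algebra (profile_space I {1..bidders I})) \<and>
     (\<forall>i\<in>{1..bidders I}.
        (\<integral>\<^sup>+a. ennreal (payment I i a) \<partial>A) \<le> budget I i \<and>
        (\<forall>A'\<in>budget_feasible I i (marginal_others I i A).
           ext_expectation (deviation I i A' (marginal_others I i A)) (utility I i)
             \<le> ext_expectation A (utility I i)))"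

definition liquid_welfare :: "auction \<Rightarrow> profile measure \<Rightarrow> ennreal" where
  "liquid_welfare I A =
     (\<Sum>i\<in>{1..bidders I}. min (\<integral>\<^sup>+a. ennreal (val I i (units_won I i a)) \<partial>A) (budget I i))"

definition feasible_allocations :: "auction \<Rightarrow> (nat \<Rightarrow> nat) set" where
  "feasible_allocations I =
     {x \<in> {1..bidders I} \<rightarrow>\<^sub>E {0..units I}. (\<Sum>i\<in>{1..bidders I}. x i) \<le> units I}"

text \<open>The supremum is a maximum: the objective is continuous on the (compact) simplex of lotteries
  over the finite set of feasible allocations.\<close>

definition optimal_liquid_welfare :: "auction \<Rightarrow> ennreal" where
  "optimal_liquid_welfare I =
     (SUP p \<in> {p :: (nat \<Rightarrow> nat) pmf. set_pmf p \<subseteq> feasible_allocations I}.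
        \<Sum>i\<in>{1..bidders I}. min (\<integral>\<^sup>+x. ennreal (val I i (x i)) \<partial>measure_pmf p) (budget I i))"

text \<open>In \<^typ>\<open>ennreal\<close>, \<open>0 / 0 = 0\<close> and \<open>x / 0 = \<infinity>\<close> for \<open>x > 0\<close>, so degenerate instances with
  zero optimum do not contribute.\<close>

definition price_of_anarchy :: ennreal where
  "price_of_anarchy =
     (SUP (I, A) \<in> {(I, A). discriminatory_auction I \<and> coarse_correlated_equilibrium I A}.
        optimal_liquid_welfare I / liquid_welfare I A)"

end

theory Submission
  imports Defs
begin

text \<open>
  Let bidder \<open>i\<close> deviate to demanding \<open>x\<close> units, \<open>x\<close> drawn from her marginal of the optimal lottery,
  at a random per-unit bid with density \<open>1 / (t (V - b))\<close>, \<open>V = v x / x\<close>. Her expected utility is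
  at least \<open>\<lambda> v x - C x / t\<close>, where \<open>\<lambda> = (1 - exp (- t)) / t\<close> and \<open>C x\<close> is the expected sum of the
  \<open>x\<close> lowest winning bids. She never pays more than \<open>v x\<close>, so mixing with the zero action makes
  the deviation affordable at the cost of replacing her expected value by its minimum with the
  budget. If \<open>\<lambda> + 1 / t \<le> 1\<close>, then each bidder's liquid welfare plus \<open>C / t\<close> is at least \<open>\<lambda>\<close> times
  her share of the optimum plus \<open>1 / t\<close> times her payment: this is the equilibrium condition if her
  value is within her budget, and follows from payment and optimum being at most the budget
  otherwise. Summed over the bidders, the costs \<open>C\<close> are at most the payments, so they cancel. The
  optimal choice is \<open>\<lambda> + 1 / t = 1\<close>, that is \<open>2 - t = exp (- t)\<close>, which \<open>t = 2 + W0 (- exp (- 2))\<close>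
  solves, and \<open>1 / \<lambda> = t / (t - 1)\<close>.
\<close>

subsection \<open>Winning bids\<close>

text \<open>The comparison is weak because the tie-breaking rule may put every other bid equal to
  \<open>b\<close> ahead of a deviation to \<open>b\<close>. The winning copies of whichever bidder
  deviates later are counted as well, so that one threshold function serves all bidders.\<close>

definition sold_above :: "auction \<Rightarrow> profile \<Rightarrow> real \<Rightarrow> nat" where
  "sold_above I a b = (\<Sum>j\<in>{1..bidders I}. if b \<le> fst (a j) then units_won I j a else 0)"

lemma finite_marginal_bids: "finite (marginal_bids I a)"
  by (simp add: marginal_bids_def)

lemma highest_bids_winners:
  assumes "discriminatory_auction I" "a \<in> space (profile_space I {1..bidders I})"
  shows "highest_bids I a (winners I a)"
  using assms by (simp add: discriminatory_auction_def)

lemma space_profile_space: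
  "space (profile_space I J) = (\<Pi>\<^sub>E j\<in>J. {0..} \<times> {0..units I})"
  by (simp add: profile_space_def action_space_def space_PiM space_pair_measure space_restrict_space)

lemma units_won_le_demand:
  assumes "highest_bids I a (winners I a)"
  shows "units_won I i a \<le> snd (a i)"
proof -
  have "{l. (i, l) \<in> winners I a} \<subseteq> {1..snd (a i)}"
    using assms by (auto simp: highest_bids_def marginal_bids_def)
  from card_mono[OF _ this] show ?thesis by (simp add: units_won_def)
qed

lemma units_won_le_units:
  assumes "discriminatory_auction I" "i \<in> {1..bidders I}" "a \<in> space (profile_space I {1..bidders I})"
  shows "units_won I i a \<le> units I"
  using units_won_le_demand[OF highest_bids_winners[OF assms(1,3)], of i]
    PiE_mem[OF assms(3)[unfolded space_profile_space] assms(2)] by auto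

lemma sold_above_eq_card:
  assumes "highest_bids I a (winners I a)"
  shows "sold_above I a b = card {(j, l) \<in> winners I a. b \<le> fst (a j)}"
proof -
  have sub: "winners I a \<subseteq> marginal_bids I a" and fin: "finite (winners I a)"
    using assms finite_marginal_bids finite_subset by (auto simp: highest_bids_def)
  have "{(j, l) \<in> winners I a. b \<le> fst (a j)}
      = (SIGMA j:{1..bidders I}. {l. (j, l) \<in> winners I a \<and> b \<le> fst (a j)})"
    using sub by (auto simp: marginal_bids_def)
  moreover have "finite {l. (j, l) \<in> winners I a \<and> b \<le> fst (a j)}" for j
    by (rule finite_subset[OF _ finite_imageI[OF fin, of snd]]) force
  ultimately have "card {(j, l) \<in> winners I a. b \<le> fst (a j)}
      = (\<Sum>j\<in>{1..bidders I}. card {l. (j, l) \<in> winners I a \<and> b \<le> fst (a j)})"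
    by simp
  also have "\<dots> = sold_above I a b"
    unfolding sold_above_def units_won_def by (rule sum.cong) auto
  finally show ?thesis ..
qed

lemma sold_above_le_units:
  assumes "highest_bids I a (winners I a)"
  shows "sold_above I a b \<le> units I"
proof -
  have "finite (winners I a)"
    using assms finite_marginal_bids finite_subset by (auto simp: highest_bids_def)
  then have "sold_above I a b \<le> card (winners I a)"
    unfolding sold_above_eq_card[OF assms] by (intro card_mono) auto
  then show ?thesis
    using assms by (simp add: highest_bids_def)
qed

text \<open>If a copy of the deviating bid loses, all units are sold and every winner bids at least
  \<open>b\<close>. The other bidders' winning copies were submitted in \<open>a\<close> too: either
  all of them win in \<open>a\<close>, and \<open>sold_above I a b\<close> counts them, or one of
  them loses there, and then every winner in \<open>a\<close> bids at least \<open>b\<close> and all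
  units are counted.\<close>

lemma units_won_deviation:
  assumes a: "highest_bids I a (winners I a)"
    and a': "highest_bids I (a(i := (b, q))) (winners I (a(i := (b, q))))"
    and i: "i \<in> {1..bidders I}"
  shows "units_won I i (a(i := (b, q))) = q
    \<or> units I \<le> units_won I i (a(i := (b, q))) + sold_above I a b"
proof (rule disjCI)
  define d where "d = a(i := (b, q))"
  define W where "W = winners I d"
  define Wa where "Wa = winners I a"
  define M where "M = marginal_bids I a"
  assume "\<not> units I \<le> units_won I i (a(i := (b, q))) + sold_above I a b"
  then have less: "units_won I i d + sold_above I a b < units I"
    by (simp add: d_def)
  have W: "W \<subseteq> marginal_bids I d" "card W = min (units I) (card (marginal_bids I d))"
    and W_max: "\<And>j l j' l'. (j, l) \<in> W \<Longrightarrow> (j', l') \<in> marginal_bids I d - W \<Longrightarrow> fst (d j') \<le> fst (d j)"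
    using a' unfolding highest_bids_def d_def[symmetric] W_def[symmetric] by fast+
  have Wa: "Wa \<subseteq> M" "card Wa = min (units I) (card M)"
    and Wa_max: "\<And>j l j' l'. (j, l) \<in> Wa \<Longrightarrow> (j', l') \<in> M - Wa \<Longrightarrow> fst (a j') \<le> fst (a j)"
    using a unfolding highest_bids_def M_def[symmetric] Wa_def[symmetric] by fast+
  have fin: "finite W" "finite Wa" "finite M"
    using W(1) Wa(1) finite_marginal_bids finite_subset unfolding M_def by blast+
  show "units_won I i (a(i := (b, q))) = q"
  proof (rule ccontr)
    assume "units_won I i (a(i := (b, q))) \<noteq> q"
    then have neq: "{l. (i, l) \<in> W} \<noteq> {1..q}"
      by (auto simp: units_won_def W_def d_def)
    have "{l. (i, l) \<in> W} \<subseteq> {1..q}"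
      using W(1) by (auto simp: marginal_bids_def d_def)
    with neq obtain m where m: "m \<in> {1..q}" "(i, m) \<notin> W"
      by blast
    then have losing: "(i, m) \<in> marginal_bids I d - W"
      using i by (auto simp: marginal_bids_def d_def)
    \<comment> \<open>A losing copy rules out that all submitted copies win, so the minimum in
      \<open>highest_bids\<close> is the supply.\<close>
    then have "card W < card (marginal_bids I d)"
      using W(1) by (intro psubset_card_mono finite_marginal_bids) auto
    then have cardW: "card W = units I"
      using W(2) by linarith
    have high: "b \<le> fst (d j)" if "(j, l) \<in> W" for j l
      using W_max[OF that losing] by (simp add: d_def)
    let ?O = "{(j, l) \<in> W. j \<noteq> i}"
    have "W = ?O \<union> Pair i ` {l. (i, l) \<in> W}"
      by auto
    moreover have "finite {l. (i, l) \<in> W}"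
      by (rule finite_subset[OF _ finite_imageI[OF fin(1), of snd]]) force
    ultimately have "card W \<le> card ?O + units_won I i d"
      using card_Un_le[of ?O "Pair i ` {l. (i, l) \<in> W}"]
      by (simp add: card_image inj_on_def units_won_def W_def)
    with cardW have cardO: "units I \<le> card ?O + units_won I i d"
      by simp
    have O: "?O \<subseteq> {(j, l) \<in> M. b \<le> fst (a j)}"
    proof clarify
      fix j l assume jl: "(j, l) \<in> W" "j \<noteq> i"
      then show "(j, l) \<in> M \<and> b \<le> fst (a j)"
        using high[OF jl(1)] W(1) by (auto simp: M_def marginal_bids_def d_def)
    qed
    have sold: "sold_above I a b = card {(j, l) \<in> Wa. b \<le> fst (a j)}"
      unfolding Wa_def by (rule sold_above_eq_card[OF a])
    show False
    proof (cases "\<exists>z\<in>?O. z \<notin> Wa")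
      case True
      then obtain j l where jl: "(j, l) \<in> M - Wa" "b \<le> fst (a j)"
        using O by blast
      then have "card Wa < card M"
        using Wa(1) fin by (intro psubset_card_mono) auto
      then have "card Wa = units I"
        using Wa(2) by linarith
      moreover have "{(j, l) \<in> Wa. b \<le> fst (a j)} = Wa"
        using Wa_max jl by fastforce
      ultimately show False
        using sold less by simp
    next
      case False
      then have "?O \<subseteq> {(j, l) \<in> Wa. b \<le> fst (a j)}"
        using O by blast
      then have "card ?O \<le> sold_above I a b"
        unfolding sold by (intro card_mono finite_subset[OF _ fin(2)]) auto
      then show False
        using cardO less by simp
    qed
  qed
qed

section \<open>Truncated sums and per-unit values\<close>

text \<open>Natural subtraction makes each term a positive part. If some term is positive, every
  other term is at most its \<open>x i\<close> since \<open>s \<le> k\<close>, and the total is at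
  most \<open>(\<Sum>i\<in>N. x i) + s - k\<close>. With \<open>s\<close> the number of units sold
  above a threshold, this bounds the claims of all bidders there.\<close>

lemma sum_truncated_le:
  fixes x :: "'a \<Rightarrow> nat"
  assumes "finite N" "(\<Sum>i\<in>N. x i) \<le> k" "s \<le> k"
  shows "(\<Sum>i\<in>N. x i + s - k) \<le> s"
proof (cases "\<exists>j\<in>N. k < x j + s")
  case True
  then obtain j where j: "j \<in> N" "k < x j + s" by blast
  have "(\<Sum>i\<in>N. x i + s - k) = (x j + s - k) + (\<Sum>i\<in>N - {j}. x i + s - k)"
    using assms(1) j(1) by (simp add: sum.remove)
  also have "\<dots> \<le> (x j + s - k) + (\<Sum>i\<in>N - {j}. x i)"
    using assms(3) by (intro add_left_mono sum_mono) auto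
  also have "\<dots> = (\<Sum>i\<in>N. x i) + s - k"
    using assms(1) j by (simp add: sum.remove)
  finally show ?thesis
    using assms(2) by linarith
next
  case False
  then have "(\<Sum>i\<in>N. x i + s - k) = 0"
    by (auto simp: not_less)
  then show ?thesis by simp
qed

text \<open>The last increment is at most each earlier one, hence at most their average
  \<open>f n / n\<close>, so the per-unit value never rises. Cross-multiplication keeps quantity 0
  in range.\<close>

lemma concave_upto_ratio_le:
  assumes "concave_upto k f" "f 0 = 0" "j \<le> q" "q \<le> k"
  shows "real j * f q \<le> real q * f j"
  using assms(3,4)
proof (induction rule: dec_induct)
  case base
  then show ?case by simp
next
  case (step n)
  have dec: "f (Suc n) - f n \<le> f (Suc m) - f m" if "m \<le> n" for m
    using that
  proof (induction rule: inc_induct)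
    case base
    then show ?case by simp
  next
    case (step m)
    have "m + 2 \<le> k" using step.hyps \<open>Suc n \<le> k\<close> by linarith
    then have "f (m + 2) - f (m + 1) \<le> f (m + 1) - f m"
      using assms(1) by (simp add: concave_upto_def)
    with step.IH show ?case by simp
  qed
  have "real n * (f (Suc n) - f n) = (\<Sum>m<n. f (Suc n) - f n)"
    by simp
  also have "\<dots> \<le> (\<Sum>m<n. f (Suc m) - f m)"
    using dec by (intro sum_mono) auto
  also have "\<dots> = f n"
    using assms(2) by (simp add: sum_lessThan_telescope)
  finally have n: "real n * f (Suc n) \<le> real (Suc n) * f n"
    by (simp add: algebra_simps)
  have IH: "real j * f n \<le> real n * f j"
    using step by simp
  show ?case
  \<comment> \<open>The factor \<open>n\<close> is cancelled below; for \<open>n = 0\<close> also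
    \<open>j = 0\<close>, and both sides vanish.\<close>
  proof (cases "n = 0")
    case True
    then show ?thesis using step assms by simp
  next
    case False
    have "real n * (real j * f (Suc n)) \<le> real j * (real (Suc n) * f n)"
      using mult_left_mono[OF n, of "real j"] by (simp add: mult_ac)
    also have "\<dots> \<le> real (Suc n) * (real n * f j)"
      using mult_left_mono[OF IH, of "real (Suc n)"] by (simp add: mult_ac)
    finally have "real n * (real j * f (Suc n)) \<le> real n * (real (Suc n) * f j)"
      by (simp add: mult_ac)
    then show ?thesis using False by simp
  qed
qed

subsection \<open>The randomized deviation\<close>

text \<open>For uniform \<open>s\<close> and \<open>V = v x / x\<close>, the bid has density \<open>1 / (t (V - b))\<close> on
  \<open>[0, V (1 - exp (- t))]\<close>.\<close>

definition deviating_action :: "auction \<Rightarrow> nat \<Rightarrow> real \<Rightarrow> nat \<times> real \<Rightarrow> action" where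
  "deviating_action I i t = (\<lambda>(x, s). if x \<le> units I \<and> s \<in> {0..1}
     then (val I i x / real x * (1 - exp (- t * s)), x) else (0, 0))"

text \<open>Layer-cake form of the sum of the \<open>q\<close> lowest winning bids, unsold units counting as bids of
  \<open>0\<close>: the integrand is \<open>(q - L b)\<^sup>+\<close>, where \<open>L b\<close> is the number of winning bids below \<open>b\<close>.
  The truncation at \<open>0\<close> is done by \<^const>\<open>ennreal\<close>.\<close>

definition supply_cost :: "auction \<Rightarrow> nat \<Rightarrow> profile \<Rightarrow> ennreal" where
  "supply_cost I q a =
     (\<integral>\<^sup>+b\<in>{0..}. ennreal (real q + real (sold_above I a b) - real (units I)) \<partial>lborel)"

section \<open>Measurability\<close>

lemma measurable_fst_action_space [measurable]: "fst \<in> borel_measurable (action_space I)"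
proof -
  have "(\<lambda>b. b) \<in> borel_measurable (restrict_space borel {0 :: real..})"
    by (intro measurable_restrict_space1) simp
  from measurable_compose[OF measurable_fst this] show ?thesis
    by (simp add: action_space_def)
qed

lemma measurable_bid:
  assumes "i \<in> J"
  shows "(\<lambda>a. fst (a i)) \<in> borel_measurable (profile_space I J)"
  unfolding profile_space_def
  by (rule measurable_compose[OF measurable_component_singleton[OF assms] measurable_fst_action_space])

lemma measurable_profile_update:
  assumes "f \<in> M \<rightarrow>\<^sub>M profile_space I J" "h \<in> M \<rightarrow>\<^sub>M action_space I"
  shows "(\<lambda>z. (f z)(i := h z)) \<in> M \<rightarrow>\<^sub>M profile_space I (insert i J)"
  using assms unfolding profile_space_def by (intro measurable_fun_upd[where J = J]) auto

lemma measurable_units_won: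
  assumes "discriminatory_auction I" "i \<in> {1..bidders I}"
  shows "units_won I i \<in> profile_space I {1..bidders I} \<rightarrow>\<^sub>M count_space UNIV"
  using assms by (simp add: discriminatory_auction_def)

lemma measurable_payment:
  assumes "discriminatory_auction I" "i \<in> {1..bidders I}"
  shows "payment I i \<in> borel_measurable (profile_space I {1..bidders I})"
proof -
  note [measurable] = measurable_units_won[OF assms] measurable_bid[OF assms(2)]
  show ?thesis unfolding payment_def by measurable
qed

lemma measurable_utility:
  assumes "discriminatory_auction I" "i \<in> {1..bidders I}"
  shows "utility I i \<in> borel_measurable (profile_space I {1..bidders I})"
proof -
  note [measurable] = measurable_units_won[OF assms] measurable_payment[OF assms]
  show ?thesis unfolding utility_def by measurable
qed

lemma measurable_sold_above:
  assumes "discriminatory_auction I"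
  shows "(\<lambda>(a, b). real (sold_above I a b))
    \<in> borel_measurable (profile_space I {1..bidders I} \<Otimes>\<^sub>M lborel)"
proof -
  have "(\<lambda>z. if snd z \<le> fst (fst z j) then real (units_won I j (fst z)) else 0)
    \<in> borel_measurable (profile_space I {1..bidders I} \<Otimes>\<^sub>M lborel)" if "j \<in> {1..bidders I}" for j
  proof -
    note [measurable] = measurable_units_won[OF assms that] measurable_bid[OF that]
    show ?thesis by measurable
  qed
  then have "(\<lambda>z. \<Sum>j\<in>{1..bidders I}. if snd z \<le> fst (fst z j) then real (units_won I j (fst z)) else 0)
    \<in> borel_measurable (profile_space I {1..bidders I} \<Otimes>\<^sub>M lborel)"
    by (rule borel_measurable_sum)
  moreover have "(\<lambda>(a, b). real (sold_above I a b))
    = (\<lambda>z. \<Sum>j\<in>{1..bidders I}. if snd z \<le> fst (fst z j) then real (units_won I j (fst z)) else 0)"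
    by (auto simp: sold_above_def fun_eq_iff intro!: sum.cong)
  ultimately show ?thesis by simp
qed

lemma measurable_supply_cost:
  assumes "discriminatory_auction I"
  shows "supply_cost I q \<in> borel_measurable (profile_space I {1..bidders I})"
proof -
  note [measurable] = measurable_sold_above[OF assms]
  show ?thesis unfolding supply_cost_def by measurable
qed

section \<open>Supply cost against payments\<close>

lemma supply_cost_0:
  assumes "highest_bids I a (winners I a)"
  shows "supply_cost I 0 a = 0"
  using sold_above_le_units[OF assms] by (simp add: supply_cost_def ennreal_neg)

text \<open>At each threshold, \<open>sum_truncated_le\<close> bounds the joint integrand by the
  number of units sold at or above it. Integration over the thresholds counts each sold unit over
  the interval from 0 to its bid, which is its price.\<close>

lemma sum_supply_cost_le_payments:
  assumes I: "discriminatory_auction I" and a: "a \<in> space (profile_space I {1..bidders I})"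
    and x: "(\<Sum>i\<in>{1..bidders I}. x i) \<le> units I"
  shows "(\<Sum>i\<in>{1..bidders I}. supply_cost I (x i) a) \<le> (\<Sum>i\<in>{1..bidders I}. ennreal (payment I i a))"
proof -
  note a_high = highest_bids_winners[OF I a]
  have [measurable]: "(\<lambda>b. real (sold_above I a b)) \<in> borel_measurable borel"
    using measurable_compose[OF measurable_Pair1'[OF a] measurable_sold_above[OF I]] by simp
  have bid: "0 \<le> fst (a i)" if "i \<in> {1..bidders I}" for i
    using PiE_mem[OF a[unfolded space_profile_space] that] by auto
  have "(\<Sum>i\<in>{1..bidders I}. supply_cost I (x i) a)
    = (\<integral>\<^sup>+b\<in>{0..}. (\<Sum>i\<in>{1..bidders I}. ennreal (real (x i) + real (sold_above I a b) - real (units I))) \<partial>lborel)"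
    unfolding supply_cost_def sum_distrib_right by (rule nn_integral_sum[symmetric]) measurable
  also have "\<dots> \<le> (\<integral>\<^sup>+b\<in>{0..}. ennreal (real (sold_above I a b)) \<partial>lborel)"
  proof (intro nn_integral_mono mult_right_mono)
    fix b :: real
    \<comment> \<open>Truncation by \<open>ennreal\<close> agrees with truncated subtraction of
      natural numbers.\<close>
    have "ennreal (real (x i) + real (sold_above I a b) - real (units I))
        = ennreal (real (x i + sold_above I a b - units I))" for i
      by (cases "units I \<le> x i + sold_above I a b") (auto simp: of_nat_diff ennreal_neg)
    then have "(\<Sum>i\<in>{1..bidders I}. ennreal (real (x i) + real (sold_above I a b) - real (units I)))
        = ennreal (real (\<Sum>i\<in>{1..bidders I}. x i + sold_above I a b - units I))"
      by (simp add: sum_ennreal)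
    also have "\<dots> \<le> ennreal (real (sold_above I a b))"
      by (intro ennreal_leI of_nat_mono sum_truncated_le x sold_above_le_units[OF a_high]) simp
    finally show "(\<Sum>i\<in>{1..bidders I}. ennreal (real (x i) + real (sold_above I a b) - real (units I)))
        \<le> ennreal (real (sold_above I a b))" .
  qed simp
  also have "\<dots> = (\<integral>\<^sup>+b. (\<Sum>j\<in>{1..bidders I}.
      ennreal (real (units_won I j a)) * indicator {0..fst (a j)} b) \<partial>lborel)"
  proof (rule nn_integral_cong)
    fix b :: real
    have "ennreal (real (sold_above I a b))
        = (\<Sum>j\<in>{1..bidders I}. ennreal (real (if b \<le> fst (a j) then units_won I j a else 0)))"
      unfolding sold_above_def of_nat_sum by (rule sum_ennreal[symmetric]) simp
    then show "ennreal (real (sold_above I a b)) * indicator {0..} b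
        = (\<Sum>j\<in>{1..bidders I}. ennreal (real (units_won I j a)) * indicator {0..fst (a j)} b)"
      by (simp only: sum_distrib_right) (rule sum.cong, simp_all split: split_indicator)
  qed
  also have "\<dots> = (\<Sum>j\<in>{1..bidders I}. ennreal (real (units_won I j a)) * ennreal (fst (a j)))"
    using bid by (subst nn_integral_sum) (simp_all add: nn_integral_cmult)
  also have "\<dots> = (\<Sum>i\<in>{1..bidders I}. ennreal (payment I i a))"
    using bid by (intro sum.cong) (auto simp: payment_def ennreal_mult mult.commute)
  finally show ?thesis .
qed

section \<open>Outcome of the randomized action against a fixed profile\<close>

text \<open>The first case includes demand 0, where division by zero makes the bid 0, so that the
  second may divide by \<open>x\<close>.\<close>

lemma deviating_action_cases:
  obtains "deviating_action I i t z = (0, 0)"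
  | x s where "z = (x, s)" "0 < x" "x \<le> units I" "s \<in> {0..1}"
      "deviating_action I i t z = (val I i x / real x * (1 - exp (- t * s)), x)"
proof (cases z)
  case (Pair x s)
  with that show ?thesis
    by (cases "x \<le> units I \<and> s \<in> {0..1} \<and> 0 < x") (auto simp: deviating_action_def)
qed

lemma deviating_action_in_space:
  assumes "discriminatory_auction I" "i \<in> {1..bidders I}" "0 \<le> t"
  shows "deviating_action I i t z \<in> {0..} \<times> {0..units I}"
  using assms by (cases I i t z rule: deviating_action_cases) (auto simp: discriminatory_auction_def)

lemma measurable_deviating_action_section:
  assumes "discriminatory_auction I" "i \<in> {1..bidders I}" "0 \<le> t"
  shows "(\<lambda>s. deviating_action I i t (x, s)) \<in> borel \<rightarrow>\<^sub>M action_space I"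
proof -
  note mem = deviating_action_in_space[OF assms]
  show "(\<lambda>s. deviating_action I i t (x, s)) \<in> borel \<rightarrow>\<^sub>M action_space I"
    unfolding action_space_def
  proof (rule measurable_pair)
    have "(\<lambda>s. if x \<le> units I \<and> s \<in> {0..1} then val I i x / real x * (1 - exp (- t * s)) else 0)
        \<in> borel_measurable borel"
      by measurable
    moreover have "(\<lambda>s. fst (deviating_action I i t (x, s)))
        = (\<lambda>s. if x \<le> units I \<and> s \<in> {0..1} then val I i x / real x * (1 - exp (- t * s)) else 0)"
      by (auto simp: deviating_action_def fun_eq_iff)
    ultimately have "(\<lambda>s. fst (deviating_action I i t (x, s))) \<in> borel_measurable borel"
      by simp
    then show "fst \<circ> (\<lambda>s. deviating_action I i t (x, s)) \<in> borel \<rightarrow>\<^sub>M restrict_space borel {0..}"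
      using mem by (auto simp: o_def mem_Times_iff intro!: measurable_restrict_space2)
    have "(\<lambda>s. if x \<le> units I \<and> s \<in> {0..1::real} then x else 0)
        \<in> borel \<rightarrow>\<^sub>M count_space {0..units I}"
      using measurable_If_set[of "\<lambda>_. x" borel "count_space {0..units I}" "\<lambda>_. 0" "{0..1}"]
      by (cases "x \<le> units I") simp_all
    moreover have "snd \<circ> (\<lambda>s. deviating_action I i t (x, s))
        = (\<lambda>s. if x \<le> units I \<and> s \<in> {0..1} then x else 0)"
      by (auto simp: deviating_action_def fun_eq_iff)
    ultimately show "snd \<circ> (\<lambda>s. deviating_action I i t (x, s)) \<in> borel \<rightarrow>\<^sub>M count_space {0..units I}"
      by simp
  qed
qed

lemma profile_update_in_space:
  assumes "a \<in> space (profile_space I {1..bidders I})" "i \<in> {1..bidders I}" "c \<in> {0..} \<times> {0..units I}"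
  shows "a(i := c) \<in> space (profile_space I {1..bidders I})"
  using assms by (auto simp: space_profile_space PiE_iff extensional_def)

text \<open>By concavity, a partial win is worth at least its proportional share of the value of the
  demanded quantity.\<close>

lemma utility_ge_surplus:
  assumes I: "discriminatory_auction I" and i: "i \<in> {1..bidders I}"
    and a: "a \<in> space (profile_space I {1..bidders I})" "a i = (b, q)" and q: "q \<le> units I"
  shows "real (units_won I i a) * (val I i q / real q - b) \<le> utility I i a"
proof -
  let ?X = "units_won I i a"
  have X: "?X \<le> q"
    using units_won_le_demand[OF highest_bids_winners[OF I a(1)], of i] a by simp
  have "real ?X * (val I i q / real q) \<le> val I i ?X"
  proof (cases "q = 0")
    case True
    then show ?thesis using X I i by (simp add: discriminatory_auction_def)
  next
    case False
    have "real ?X * val I i q \<le> real q * val I i ?X"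
      using I i X q by (intro concave_upto_ratio_le[of "units I"]) (auto simp: discriminatory_auction_def)
    then show ?thesis using False by (simp add: field_simps)
  qed
  then show ?thesis
    using a(2) by (simp add: utility_def payment_def algebra_simps)
qed

text \<open>At the chosen bid the surplus per unit is
  \<open>val I i x / real x * exp (- t * s)\<close>. By \<open>units_won_deviation\<close>, at most
  the positive part of \<open>x + sold_above - units\<close> is missing from the \<open>x\<close>
  demanded units, and the last claim charges the surplus for each missing unit. The first claim
  later removes the negative part of the utility, the second secures budget feasibility.\<close>

lemma utility_deviating_action:
  assumes I: "discriminatory_auction I" and i: "i \<in> {1..bidders I}" and t: "0 \<le> t"
    and a: "a \<in> space (profile_space I {1..bidders I})"
  shows "0 \<le> utility I i (a(i := deviating_action I i t z))"
    and "payment I i (a(i := deviating_action I i t z)) \<le> (if fst z \<le> units I then val I i (fst z) else 0)"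
    and "\<lbrakk>x \<le> units I; s \<in> {0..1}\<rbrakk> \<Longrightarrow>
      ennreal (val I i x * exp (- t * s)) \<le> ennreal (utility I i (a(i := deviating_action I i t (x, s))))
        + ennreal (real x + real (sold_above I a (val I i x / real x * (1 - exp (- t * s)))) - real (units I))
          * ennreal (val I i x / real x * exp (- t * s))"
proof -
  note mem = profile_update_in_space[OF a i deviating_action_in_space[OF I i t]]
  have val: "0 \<le> val I i x" if "x \<le> units I" for x
    using I i that by (simp add: discriminatory_auction_def)
  have won: "units_won I i (a(i := deviating_action I i t z)) \<le> snd (deviating_action I i t z)" for z
    using units_won_le_demand[OF highest_bids_winners[OF I mem], of i z] by simp
  have surplus: "real (units_won I i (a(i := deviating_action I i t (x, s)))) * (val I i x / real x * exp (- t * s))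
      \<le> utility I i (a(i := deviating_action I i t (x, s)))"
    if "x \<le> units I" "s \<in> {0..1}" for x s
  proof -
    have "val I i x / real x - val I i x / real x * (1 - exp (- t * s)) = val I i x / real x * exp (- t * s)"
      by (simp add: right_diff_distrib)
    with utility_ge_surplus[OF I i mem, of "(x, s)" "val I i x / real x * (1 - exp (- t * s))" x] that
    show ?thesis by (simp only: deviating_action_def) simp
  qed
  show nonneg: "0 \<le> utility I i (a(i := deviating_action I i t z))" for z
  proof (cases I i t z rule: deviating_action_cases)
    case 1
    then show ?thesis
      using utility_ge_surplus[OF I i mem, of z 0 0] by simp
  next
    case (2 x s)
    have "0 \<le> real (units_won I i (a(i := deviating_action I i t (x, s)))) * (val I i x / real x * exp (- t * s))"
      using val[OF 2(3)] by simp
    with surplus[OF 2(3,4)] 2(1) show ?thesis by simp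
  qed
  show "payment I i (a(i := deviating_action I i t z)) \<le> (if fst z \<le> units I then val I i (fst z) else 0)"
  proof (cases I i t z rule: deviating_action_cases)
    case 1
    then show ?thesis
      using val by (simp add: payment_def)
  next
    case (2 x s)
    have s: "0 \<le> 1 - exp (- t * s)" "1 - exp (- t * s) \<le> 1"
      using 2(4) t by simp_all
    have "payment I i (a(i := deviating_action I i t z)) = val I i x / real x * (1 - exp (- t * s))
        * real (units_won I i (a(i := deviating_action I i t z)))"
      by (simp only: payment_def 2(5) fun_upd_same fst_conv)
    also have "\<dots> \<le> val I i x / real x * (1 - exp (- t * s)) * real x"
      using won[of z] 2 val[OF 2(3)] s(1)
      by (intro mult_left_mono mult_nonneg_nonneg divide_nonneg_nonneg) simp_all
    also have "\<dots> \<le> val I i x"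
      using s val[OF 2(3)] 2(2) by (simp add: mult_left_le)
    finally show ?thesis using 2 by simp
  qed
  assume xs: "x \<le> units I" "s \<in> {0..1}"
  define b where "b = val I i x / real x * (1 - exp (- t * s))"
  define w where "w = val I i x / real x * exp (- t * s)"
  define X where "X = units_won I i (a(i := deviating_action I i t (x, s)))"
  have w: "0 \<le> w" using val[OF xs(1)] by (simp add: w_def)
  have dev: "deviating_action I i t (x, s) = (b, x)"
    using xs by (simp add: deviating_action_def b_def)
  have "X = x \<or> units I \<le> X + sold_above I a b"
    using units_won_deviation[OF highest_bids_winners[OF I a] _ i, of b x]
      highest_bids_winners[OF I mem[of "(x, s)"]] by (simp add: dev X_def)
  then have "real x \<le> real X + max 0 (real x + real (sold_above I a b) - real (units I))"
    by linarith
  then have "real x * w \<le> (real X + max 0 (real x + real (sold_above I a b) - real (units I))) * w"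
    using w by (rule mult_right_mono)
  also have "\<dots> \<le> utility I i (a(i := deviating_action I i t (x, s)))
      + max 0 (real x + real (sold_above I a b) - real (units I)) * w"
    using surplus[OF xs] by (simp add: X_def w_def algebra_simps)
  finally have "real x * w \<le> utility I i (a(i := deviating_action I i t (x, s)))
      + max 0 (real x + real (sold_above I a b) - real (units I)) * w" .
  \<comment> \<open>For \<open>x = 0\<close> both sides are 0, because
    \<open>val I i 0 = 0\<close>.\<close>
  moreover have "real x * w = val I i x * exp (- t * s)"
    using I i by (cases "x = 0") (auto simp: w_def discriminatory_auction_def)
  ultimately have "ennreal (val I i x * exp (- t * s))
      \<le> ennreal (utility I i (a(i := deviating_action I i t (x, s)))
      + max 0 (real x + real (sold_above I a b) - real (units I)) * w)"
    by (intro ennreal_leI) simp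
  also have "\<dots> = ennreal (utility I i (a(i := deviating_action I i t (x, s))))
      + ennreal (real x + real (sold_above I a b) - real (units I)) * ennreal w"
    using w nonneg[of "(x, s)"]
    by (simp add: ennreal_plus ennreal_mult)
  finally show "ennreal (val I i x * exp (- t * s)) \<le> ennreal (utility I i (a(i := deviating_action I i t (x, s))))
        + ennreal (real x + real (sold_above I a (val I i x / real x * (1 - exp (- t * s)))) - real (units I))
          * ennreal (val I i x / real x * exp (- t * s))"
    by (simp add: b_def w_def)
qed

section \<open>Expectations under independent deviations\<close>

text \<open>Overwriting coordinate \<open>i\<close> erases exactly what the marginal of the others
  has forgotten, so the others may be drawn from \<open>A\<close> itself.\<close>

lemma nn_integral_deviation:
  assumes i: "i \<in> {1..bidders I}"
    and A: "A \<in> space (prob_algebra (profile_space I {1..bidders I}))"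
    and A': "A' \<in> space (prob_algebra (action_space I))"
    and f: "f \<in> borel_measurable (profile_space I {1..bidders I})"
  shows "(\<integral>\<^sup>+a. f a \<partial>deviation I i A' (marginal_others I i A)) = (\<integral>\<^sup>+c. \<integral>\<^sup>+a. f (a(i := c)) \<partial>A \<partial>A')"
proof -
  let ?N = "{1..bidders I}"
  let ?D = "marginal_others I i A"
  have sets_A [measurable_cong]: "sets A = sets (profile_space I ?N)" and "prob_space A"
    and sets_A' [measurable_cong]: "sets A' = sets (action_space I)"
    using A A' by (auto simp: space_prob_algebra)
  have restr: "(\<lambda>a. restrict a (?N - {i})) \<in> A \<rightarrow>\<^sub>M profile_space I (?N - {i})"
    unfolding measurable_cong_sets[OF sets_A refl] profile_space_def
    by (rule measurable_restrict_subset) auto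
  interpret D: prob_space ?D
    unfolding marginal_others_def by (rule prob_space.prob_space_distr[OF \<open>prob_space A\<close> restr])
  have sets_D [measurable_cong]: "sets ?D = sets (profile_space I (?N - {i}))"
    by (simp add: marginal_others_def)
  have upd: "(\<lambda>(c, a). a(i := c)) \<in> A' \<Otimes>\<^sub>M ?D \<rightarrow>\<^sub>M profile_space I ?N"
  proof -
    have "snd \<in> A' \<Otimes>\<^sub>M ?D \<rightarrow>\<^sub>M profile_space I (?N - {i})" "fst \<in> A' \<Otimes>\<^sub>M ?D \<rightarrow>\<^sub>M action_space I"
      by measurable
    from measurable_profile_update[OF this, of i] show ?thesis
      using i by (simp add: case_prod_beta' insert_absorb)
  qed
  have "(\<integral>\<^sup>+a. f a \<partial>deviation I i A' ?D) = (\<integral>\<^sup>+z. f ((\<lambda>(c, a). a(i := c)) z) \<partial>(A' \<Otimes>\<^sub>M ?D))"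
    unfolding deviation_def by (rule nn_integral_distr[OF upd]) (use f in simp)
  also have "\<dots> = (\<integral>\<^sup>+c. \<integral>\<^sup>+a. f (a(i := c)) \<partial>?D \<partial>A')"
    by (subst D.nn_integral_fst[OF measurable_compose[OF upd f], symmetric]) simp
  also have "\<dots> = (\<integral>\<^sup>+c. \<integral>\<^sup>+a. f (a(i := c)) \<partial>A \<partial>A')"
  proof (rule nn_integral_cong)
    fix c assume c: "c \<in> space A'"
    have "(\<lambda>a. f (a(i := c))) \<in> borel_measurable ?D"
      using measurable_compose[OF measurable_Pair1'[OF c] measurable_compose[OF upd f]] by simp
    then have "(\<integral>\<^sup>+a. f (a(i := c)) \<partial>?D) = (\<integral>\<^sup>+a. f ((restrict a (?N - {i}))(i := c)) \<partial>A)"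
      unfolding marginal_others_def by (subst nn_integral_distr[OF restr]) simp_all
    also have "\<dots> = (\<integral>\<^sup>+a. f (a(i := c)) \<partial>A)"
    proof (rule nn_integral_cong)
      fix a assume "a \<in> space A"
      \<comment> \<open>Outside the index set both the profile and its restriction are
        \<open>undefined\<close>, so the two updated functions agree everywhere.\<close>
      then have "a \<in> extensional ?N"
        by (simp add: sets_eq_imp_space_eq[OF sets_A] space_profile_space PiE_def)
      then have "(restrict a (?N - {i}))(i := c) = a(i := c)"
        by (auto simp: fun_eq_iff extensional_def)
      then show "f ((restrict a (?N - {i}))(i := c)) = f (a(i := c))" by simp
    qed
    finally show "(\<integral>\<^sup>+a. f (a(i := c)) \<partial>?D) = (\<integral>\<^sup>+a. f (a(i := c)) \<partial>A)" .
  qed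
  finally show ?thesis .
qed

abbreviation unit_uniform :: "real measure" where
  "unit_uniform \<equiv> uniform_measure lborel {0..1}"

lemma prob_space_unit_uniform: "prob_space unit_uniform"
  by (rule prob_space_uniform_measure) simp_all

text \<open>The law \<open>p\<close> of the demand stays general: besides a marginal of a lottery
  over allocations, it is used with demand 0 mixed in and with demand 0 alone.\<close>

definition mixed_deviation :: "auction \<Rightarrow> nat \<Rightarrow> real \<Rightarrow> nat pmf \<Rightarrow> action measure" where
  "mixed_deviation I i t p =
     distr (measure_pmf p \<Otimes>\<^sub>M unit_uniform) (action_space I) (deviating_action I i t)"

text \<open>The demand is discrete, so measurability of each section in \<open>s\<close> is
  enough.\<close>

lemma measurable_deviating_action:
  assumes "discriminatory_auction I" "i \<in> {1..bidders I}" "0 \<le> t"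
  shows "deviating_action I i t \<in> measure_pmf p \<Otimes>\<^sub>M unit_uniform \<rightarrow>\<^sub>M action_space I"
proof -
  have "sets (measure_pmf p \<Otimes>\<^sub>M unit_uniform) = sets (count_space UNIV \<Otimes>\<^sub>M (borel :: real measure))"
    by (intro sets_pair_measure_cong) simp_all
  moreover have "deviating_action I i t \<in> count_space UNIV \<Otimes>\<^sub>M borel \<rightarrow>\<^sub>M action_space I"
    using measurable_deviating_action_section[OF assms] by (intro measurable_pair_measure_countable1) auto
  ultimately show ?thesis
    by (simp cong: measurable_cong_sets)
qed

lemma mixed_deviation_in_prob_algebra:
  assumes "discriminatory_auction I" "i \<in> {1..bidders I}" "0 \<le> t"
  shows "mixed_deviation I i t p \<in> space (prob_algebra (action_space I))"
proof -
  interpret prob_space unit_uniform by (rule prob_space_unit_uniform)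
  interpret pair_prob_space "measure_pmf p" unit_uniform ..
  show ?thesis
    unfolding mixed_deviation_def space_prob_algebra
    using P.prob_space_distr[OF measurable_deviating_action[OF assms]] by simp
qed

text \<open>The integral over \<open>s\<close> is moved innermost, where profile and demand are
  fixed as in \<open>deviation_guarantee\<close>.\<close>

lemma nn_integral_mixed_deviation:
  assumes I: "discriminatory_auction I" and i: "i \<in> {1..bidders I}" and t: "0 \<le> t"
    and A: "A \<in> space (prob_algebra (profile_space I {1..bidders I}))"
    and f: "f \<in> borel_measurable (profile_space I {1..bidders I})"
  shows "(\<integral>\<^sup>+a. f a \<partial>deviation I i (mixed_deviation I i t p) (marginal_others I i A))
    = (\<integral>\<^sup>+x. \<integral>\<^sup>+a. \<integral>\<^sup>+s. f (a(i := deviating_action I i t (x, s))) \<partial>unit_uniform \<partial>A \<partial>measure_pmf p)"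
proof -
  interpret U: prob_space unit_uniform by (rule prob_space_unit_uniform)
  have sets_A [measurable_cong]: "sets A = sets (profile_space I {1..bidders I})" and "prob_space A"
    using A by (auto simp: space_prob_algebra)
  interpret A: prob_space A by fact
  interpret UA: pair_sigma_finite A unit_uniform ..
  note dev = measurable_deviating_action[OF I i t]
  have upd: "(\<lambda>(c, a). a(i := c)) \<in> action_space I \<Otimes>\<^sub>M A \<rightarrow>\<^sub>M profile_space I {1..bidders I}"
  proof -
    have "snd \<in> action_space I \<Otimes>\<^sub>M A \<rightarrow>\<^sub>M profile_space I {1..bidders I}"
      "fst \<in> action_space I \<Otimes>\<^sub>M A \<rightarrow>\<^sub>M action_space I"
      by measurable
    from measurable_profile_update[OF this, of i] show ?thesis
      using i by (simp add: case_prod_beta' insert_absorb)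
  qed
  have f_upd [measurable]: "(\<lambda>(c, a). f (a(i := c))) \<in> borel_measurable (action_space I \<Otimes>\<^sub>M A)"
    using measurable_compose[OF upd f] by (simp add: case_prod_beta')
  have g: "(\<lambda>c. \<integral>\<^sup>+a. f (a(i := c)) \<partial>A) \<in> borel_measurable (action_space I)"
    by measurable
  have "(\<integral>\<^sup>+a. f a \<partial>deviation I i (mixed_deviation I i t p) (marginal_others I i A))
    = (\<integral>\<^sup>+z. \<integral>\<^sup>+a. f (a(i := deviating_action I i t z)) \<partial>A \<partial>(measure_pmf p \<Otimes>\<^sub>M unit_uniform))"
    unfolding nn_integral_deviation[OF i A mixed_deviation_in_prob_algebra[OF I i t] f]
    unfolding mixed_deviation_def
    by (rule nn_integral_distr[OF dev]) (use g in simp)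
  also have "\<dots> = (\<integral>\<^sup>+x. \<integral>\<^sup>+s. \<integral>\<^sup>+a. f (a(i := deviating_action I i t (x, s))) \<partial>A \<partial>unit_uniform \<partial>measure_pmf p)"
    by (subst U.nn_integral_fst[OF measurable_compose[OF dev g], symmetric]) simp
  also have "\<dots> = (\<integral>\<^sup>+x. \<integral>\<^sup>+a. \<integral>\<^sup>+s. f (a(i := deviating_action I i t (x, s))) \<partial>unit_uniform \<partial>A \<partial>measure_pmf p)"
  proof (rule nn_integral_cong)
    fix x
    have [measurable]: "(\<lambda>s. deviating_action I i t (x, s)) \<in> borel \<rightarrow>\<^sub>M action_space I"
      by (rule measurable_deviating_action_section[OF I i t])
    have "(\<lambda>z. (\<lambda>(c, a). f (a(i := c))) (deviating_action I i t (x, snd z), fst z))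
        \<in> borel_measurable (A \<Otimes>\<^sub>M unit_uniform)"
      by measurable
    then have "(\<lambda>(a, s). f (a(i := deviating_action I i t (x, s)))) \<in> borel_measurable (A \<Otimes>\<^sub>M unit_uniform)"
      by (simp add: case_prod_beta')
    then show "(\<integral>\<^sup>+s. \<integral>\<^sup>+a. f (a(i := deviating_action I i t (x, s))) \<partial>A \<partial>unit_uniform)
      = (\<integral>\<^sup>+a. \<integral>\<^sup>+s. f (a(i := deviating_action I i t (x, s))) \<partial>unit_uniform \<partial>A)"
      by (rule UA.Fubini')
  qed
  finally show ?thesis .
qed

text \<open>The last claim of \<open>utility_deviating_action\<close> is averaged over
  \<open>s\<close>; its left-hand side integrates to the one here. In the loss term, the
  substitution \<open>b = g s\<close> has derivative \<open>V * (t * exp (- t * s))\<close>, so the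
  surplus \<open>V * exp (- t * s)\<close> per missing unit becomes the constant
  \<open>1 / t\<close> with respect to \<open>b\<close>. Then \<open>V\<close> matters only for the
  range of \<open>b\<close>.\<close>

lemma deviation_guarantee:
  assumes I: "discriminatory_auction I" and i: "i \<in> {1..bidders I}" and t: "0 < t"
    and a: "a \<in> space (profile_space I {1..bidders I})" and x: "x \<le> units I"
  shows "ennreal ((1 - exp (- t)) / t * val I i x)
    \<le> (\<integral>\<^sup>+s. ennreal (utility I i (a(i := deviating_action I i t (x, s)))) \<partial>unit_uniform)
      + ennreal (1 / t) * supply_cost I x a"
proof -
  have t': "0 \<le> t" using t by simp
  define V where "V = val I i x / real x"
  have val: "0 \<le> val I i x"
    using I i x by (simp add: discriminatory_auction_def)
  then have V: "0 \<le> V" by (simp add: V_def)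
  define e where "e b = max 0 (real x + real (sold_above I a b) - real (units I))" for b
  have "(\<lambda>b. real (sold_above I a b)) \<in> borel_measurable borel"
    using measurable_compose[OF measurable_Pair1'[OF a] measurable_sold_above[OF I]] by simp
  then have e [measurable]: "e \<in> borel_measurable borel"
    unfolding e_def by measurable
  have e_ennreal: "ennreal (real x + real (sold_above I a b) - real (units I)) = ennreal (e b)" for b
    by (simp add: e_def ennreal_max_0)
  have e_nonneg: "0 \<le> e b" for b by (simp add: e_def)
  define u where "u s = ennreal (utility I i (a(i := deviating_action I i t (x, s))))" for s
  have u [measurable]: "u \<in> borel_measurable borel"
  proof -
    have "(\<lambda>s. a(i := deviating_action I i t (x, s))) \<in> borel \<rightarrow>\<^sub>M profile_space I {1..bidders I}"
      using measurable_profile_update[of "\<lambda>_. a" borel I "{1..bidders I}" _ i,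
          OF _ measurable_deviating_action_section[OF I i t']] a i
      by (simp add: insert_absorb)
    from measurable_compose[OF this measurable_utility[OF I i]] show ?thesis
      unfolding u_def by measurable
  qed
  define g where "g s = V * (1 - exp (- t * s))" for s
  define g' where "g' s = V * (t * exp (- t * s))" for s
  have g [measurable]: "g \<in> borel_measurable borel"
    unfolding g_def by measurable
  have "ennreal ((1 - exp (- t)) / t * val I i x)
      = ennreal (- (val I i x / t * exp (- t * 1)) - (- (val I i x / t * exp (- t * 0))))"
    using t by (simp add: field_simps)
  also have "\<dots> = (\<integral>\<^sup>+s. ennreal (val I i x * exp (- t * s)) * indicator {0..1} s \<partial>lborel)"
    by (rule nn_integral_FTC_Icc[symmetric])
       (use t val in \<open>auto intro!: derivative_eq_intros\<close>)
  also have "\<dots> \<le> (\<integral>\<^sup>+s. u s * indicator {0..1} s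
      + ennreal (1 / t) * ennreal (e (g s) * g' s * indicator {0..1} s) \<partial>lborel)"
  proof (intro nn_integral_mono)
    fix s :: real
    show "ennreal (val I i x * exp (- t * s)) * indicator {0..1} s \<le> u s * indicator {0..1} s
      + ennreal (1 / t) * ennreal (e (g s) * g' s * indicator {0..1} s)"
    proof (cases "s \<in> {0..1}")
      case True
      have "ennreal (val I i x * exp (- t * s)) \<le> u s + ennreal (e (g s)) * ennreal (V * exp (- t * s))"
        using utility_deviating_action(3)[OF I i t' a x True]
        unfolding u_def V_def g_def e_ennreal by simp
      also have "ennreal (e (g s)) * ennreal (V * exp (- t * s)) = ennreal (1 / t) * ennreal (e (g s) * g' s)"
        using t V e_nonneg by (simp add: g'_def flip: ennreal_mult)
      finally show ?thesis using True by simp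
    qed simp
  qed
  also have "\<dots> = (\<integral>\<^sup>+s. u s * indicator {0..1} s \<partial>lborel)
      + ennreal (1 / t) * (\<integral>\<^sup>+s. ennreal (e (g s) * g' s * indicator {0..1} s) \<partial>lborel)"
    unfolding g'_def by (simp add: nn_integral_add nn_integral_cmult)
  also have "(\<integral>\<^sup>+s. ennreal (e (g s) * g' s * indicator {0..1} s) \<partial>lborel)
      = (\<integral>\<^sup>+b. ennreal (e b * indicator {g 0..g 1} b) \<partial>lborel)"
  proof (rule nn_integral_substitution[symmetric])
    show "set_borel_measurable borel {g 0..g 1} e"
      unfolding set_borel_measurable_def by measurable
    show "(g has_real_derivative g' s) (at s)" for s
      unfolding g_def g'_def by (auto intro!: derivative_eq_intros)
    show "continuous_on {0..1} g'"
      unfolding g'_def by (intro continuous_intros)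
  qed (use t V in \<open>simp_all add: g'_def\<close>)
  \<comment> \<open>Since \<open>g 0 = 0\<close>, extending the range \<open>{g 0..g 1}\<close> to
    all nonnegative bids only adds to the cost.\<close>
  also have "\<dots> \<le> supply_cost I x a"
    unfolding supply_cost_def e_ennreal
    by (intro nn_integral_mono) (auto simp: g_def split: split_indicator)
  also have "(\<integral>\<^sup>+s. u s * indicator {0..1} s \<partial>lborel) = (\<integral>\<^sup>+s. u s \<partial>unit_uniform)"
    by (subst nn_integral_uniform_measure) (simp_all add: divide_ennreal_def)
  finally show ?thesis
    by (simp add: u_def add_left_mono mult_left_mono)
qed

subsection \<open>Liquid welfare in equilibrium\<close>

text \<open>With \<open>v\<close> the value and \<open>r\<close> the payment, this relates utility,
  value and payment without subtracting expectations that might be infinite.\<close>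

lemma ennreal_add_neg_diff:
  fixes v r :: real
  assumes "0 \<le> v" "0 \<le> r"
  shows "ennreal v + ennreal (- (v - r)) = ennreal (v - r) + ennreal r"
  using assms by (cases "r \<le> v") (simp_all add: ennreal_neg flip: ennreal_plus)

text \<open>If \<open>y\<close> were infinite, the difference would be minus infinity, below every
  \<open>enn2ereal d\<close>. A finite \<open>y\<close> can be moved to the left.\<close>

lemma ereal_le_diff_imp_add_le:
  fixes d x y :: ennreal
  assumes "enn2ereal d \<le> enn2ereal x - enn2ereal y" "x < \<infinity>"
  shows "y < \<infinity>" "d + y \<le> x"
  using assms by (cases d; cases x; cases y; simp add: enn2ereal_ennreal top_ereal_def flip: ennreal_plus)+

lemma nn_integral_le_bound:
  assumes "prob_space M" "\<And>z. z \<in> space M \<Longrightarrow> f z \<le> ennreal c"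
  shows "(\<integral>\<^sup>+z. f z \<partial>M) \<le> ennreal c"
proof -
  interpret prob_space M by fact
  have "(\<integral>\<^sup>+z. f z \<partial>M) \<le> (\<integral>\<^sup>+z. ennreal c \<partial>M)"
    using assms(2) by (rule nn_integral_mono)
  then show ?thesis by (simp add: emeasure_space_1)
qed

lemma val_le_Max:
  "j \<le> units I \<Longrightarrow> val I i j \<le> Max (val I i ` {..units I})"
  by (intro Max_ge) auto

lemma coarse_correlated_equilibriumD:
  assumes "coarse_correlated_equilibrium I A"
  shows "A \<in> space (prob_algebra (profile_space I {1..bidders I}))"
    "prob_space A" "sets A = sets (profile_space I {1..bidders I})"
    "space A = space (profile_space I {1..bidders I})"
proof -
  show "A \<in> space (prob_algebra (profile_space I {1..bidders I}))"
    using assms by (simp add: coarse_correlated_equilibrium_def)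
  then show "prob_space A" "sets A = sets (profile_space I {1..bidders I})"
    by (simp_all add: space_prob_algebra)
  then show "space A = space (profile_space I {1..bidders I})"
    by (intro sets_eq_imp_space_eq)
qed

section \<open>Bounds for a single bidder\<close>

text \<open>The deviation never costs more than the value of the drawn demand, so the second
  hypothesis on \<open>p\<close> makes it budget feasible. Its utility is nonnegative, so the
  equilibrium condition bounds a single integral \<open>E\<close>; the payment is moved to the side
  of \<open>E\<close>, and \<open>deviation_guarantee\<close> is averaged over profile and
  demand.\<close>

lemma bidder_deviation_bound:
  assumes I: "discriminatory_auction I" and cce: "coarse_correlated_equilibrium I A"
    and i: "i \<in> {1..bidders I}" and t: "0 < t"
    and p: "set_pmf p \<subseteq> {..units I}" "(\<integral>\<^sup>+x. ennreal (val I i x) \<partial>measure_pmf p) \<le> budget I i"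
  shows "ennreal ((1 - exp (- t)) / t) * (\<integral>\<^sup>+x. ennreal (val I i x) \<partial>measure_pmf p)
      + (\<integral>\<^sup>+a. ennreal (payment I i a) \<partial>A)
    \<le> (\<integral>\<^sup>+a. ennreal (val I i (units_won I i a)) \<partial>A)
      + ennreal (1 / t) * (\<integral>\<^sup>+x. \<integral>\<^sup>+a. supply_cost I x a \<partial>A \<partial>measure_pmf p)"
proof -
  have t': "0 \<le> t" using t by simp
  note A = coarse_correlated_equilibriumD(1)[OF cce]
  note sets_A [measurable_cong] = coarse_correlated_equilibriumD(3)[OF cce]
  note space_A = coarse_correlated_equilibriumD(4)[OF cce]
  interpret A: prob_space A by (rule coarse_correlated_equilibriumD(2)[OF cce])
  interpret U: prob_space unit_uniform by (rule prob_space_unit_uniform)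
  note [measurable] = measurable_utility[OF I i] measurable_payment[OF I i] measurable_units_won[OF I i]
    measurable_supply_cost[OF I]
  have val: "0 \<le> val I i x" if "x \<le> units I" for x
    using I i that by (simp add: discriminatory_auction_def)
  define A' where "A' = mixed_deviation I i t p"
  define M where "M = deviation I i A' (marginal_others I i A)"
  define E where "E = (\<integral>\<^sup>+a. ennreal (utility I i a) \<partial>M)"
  note int_M = nn_integral_mixed_deviation[OF I i t' A, of _ p, folded A'_def M_def]
  have "(\<integral>\<^sup>+a. ennreal (payment I i a) \<partial>M) \<le> (\<integral>\<^sup>+x. ennreal (val I i x) \<partial>measure_pmf p)"
  proof (subst int_M)
    show "(\<integral>\<^sup>+x. \<integral>\<^sup>+a. \<integral>\<^sup>+s. ennreal (payment I i (a(i := deviating_action I i t (x, s)))) \<partial>unit_uniform \<partial>A \<partial>measure_pmf p)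
      \<le> (\<integral>\<^sup>+x. ennreal (val I i x) \<partial>measure_pmf p)"
    proof (rule nn_integral_mono_AE, rule AE_pmfI)
      fix x assume "x \<in> set_pmf p"
      then have "x \<le> units I" using p by auto
      then have "ennreal (payment I i (a(i := deviating_action I i t (x, s)))) \<le> ennreal (val I i x)"
        if "a \<in> space A" for a s
        using utility_deviating_action(2)[OF I i t' that[unfolded space_A], of "(x, s)"]
        by (intro ennreal_leI) simp
      then show "(\<integral>\<^sup>+a. \<integral>\<^sup>+s. ennreal (payment I i (a(i := deviating_action I i t (x, s)))) \<partial>unit_uniform \<partial>A)
          \<le> ennreal (val I i x)"
        by (intro nn_integral_le_bound A.prob_space_axioms U.prob_space_axioms)
    qed
  qed measurable
  with p(2) have feasible: "A' \<in> budget_feasible I i (marginal_others I i A)"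
    unfolding budget_feasible_def A'_def M_def
    using mixed_deviation_in_prob_algebra[OF I i t'] by auto
  have "(\<integral>\<^sup>+a. ennreal (- utility I i a) \<partial>M) = (\<integral>\<^sup>+x. \<integral>\<^sup>+a. 0 \<partial>A \<partial>measure_pmf p)"
  proof (subst int_M)
    have "(\<integral>\<^sup>+s. ennreal (- utility I i (a(i := deviating_action I i t (x, s)))) \<partial>unit_uniform) = 0"
      if "a \<in> space A" for a x
      using utility_deviating_action(1)[OF I i t' that[unfolded space_A]]
      by (simp add: ennreal_neg)
    then show "(\<integral>\<^sup>+x. \<integral>\<^sup>+a. \<integral>\<^sup>+s. ennreal (- utility I i (a(i := deviating_action I i t (x, s)))) \<partial>unit_uniform \<partial>A \<partial>measure_pmf p)
      = (\<integral>\<^sup>+x. \<integral>\<^sup>+a. 0 \<partial>A \<partial>measure_pmf p)"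
      by (intro nn_integral_cong)
  qed measurable
  then have "ext_expectation M (utility I i) = enn2ereal E"
    by (simp add: ext_expectation_def E_def zero_ennreal.rep_eq)
  moreover have "ext_expectation M (utility I i) \<le> ext_expectation A (utility I i)"
    using cce i feasible by (simp add: coarse_correlated_equilibrium_def M_def)
  ultimately have E_le: "enn2ereal E \<le> enn2ereal (\<integral>\<^sup>+a. ennreal (utility I i a) \<partial>A)
      - enn2ereal (\<integral>\<^sup>+a. ennreal (- utility I i a) \<partial>A)"
    by (simp add: ext_expectation_def)
  have won: "units_won I i a \<le> units I" and pay: "0 \<le> payment I i a" if "a \<in> space A" for a
    using units_won_le_units[OF I i that[unfolded space_A]]
      PiE_mem[OF that[unfolded space_A space_profile_space] i] by (auto simp: payment_def)
  have "(\<integral>\<^sup>+a. ennreal (utility I i a) \<partial>A) \<le> ennreal (Max (val I i ` {..units I}))"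
  proof (rule nn_integral_le_bound)
    fix a assume "a \<in> space A"
    then show "ennreal (utility I i a) \<le> ennreal (Max (val I i ` {..units I}))"
      using won pay val_le_Max[of "units_won I i a" I i]
      by (intro ennreal_leI) (fastforce simp: utility_def)
  qed (rule A.prob_space_axioms)
  then have "(\<integral>\<^sup>+a. ennreal (utility I i a) \<partial>A) < \<infinity>"
    using le_less_trans ennreal_less_top by fastforce
  \<comment> \<open>Utility is at most the largest value, so its positive part is finite in
    expectation. The equilibrium inequality then forces a finite negative part, which is cancelled
    in \<open>E_pay\<close>.\<close>
  note neg = ereal_le_diff_imp_add_le[OF E_le this]
  have "(\<integral>\<^sup>+a. ennreal (utility I i a) \<partial>A) + (\<integral>\<^sup>+a. ennreal (payment I i a) \<partial>A)
      = (\<integral>\<^sup>+a. ennreal (utility I i a) + ennreal (payment I i a) \<partial>A)"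
    by (rule nn_integral_add[symmetric]) measurable
  also have "\<dots> = (\<integral>\<^sup>+a. ennreal (val I i (units_won I i a)) + ennreal (- utility I i a) \<partial>A)"
    unfolding utility_def
    by (intro nn_integral_cong ennreal_add_neg_diff[symmetric]) (use won pay val in blast)+
  also have "\<dots> = (\<integral>\<^sup>+a. ennreal (val I i (units_won I i a)) \<partial>A) + (\<integral>\<^sup>+a. ennreal (- utility I i a) \<partial>A)"
    by (rule nn_integral_add) measurable
  finally have "(E + (\<integral>\<^sup>+a. ennreal (payment I i a) \<partial>A)) + (\<integral>\<^sup>+a. ennreal (- utility I i a) \<partial>A)
      \<le> (\<integral>\<^sup>+a. ennreal (val I i (units_won I i a)) \<partial>A) + (\<integral>\<^sup>+a. ennreal (- utility I i a) \<partial>A)"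
    using add_right_mono[OF neg(2), of "\<integral>\<^sup>+a. ennreal (payment I i a) \<partial>A"] by (simp add: add_ac)
  then have E_pay: "E + (\<integral>\<^sup>+a. ennreal (payment I i a) \<partial>A) \<le> (\<integral>\<^sup>+a. ennreal (val I i (units_won I i a)) \<partial>A)"
    using neg(1) by (auto simp: add.commute[of _ "\<integral>\<^sup>+a. ennreal (- utility I i a) \<partial>A"] ennreal_add_left_cancel_le)
  let ?l = "(1 - exp (- t)) / t"
  have "ennreal ?l * (\<integral>\<^sup>+x. ennreal (val I i x) \<partial>measure_pmf p)
    = (\<integral>\<^sup>+x. ennreal ?l * ennreal (val I i x) \<partial>measure_pmf p)"
    by (simp add: nn_integral_cmult)
  also have "\<dots> \<le> (\<integral>\<^sup>+x. (\<integral>\<^sup>+a. \<integral>\<^sup>+s. ennreal (utility I i (a(i := deviating_action I i t (x, s)))) \<partial>unit_uniform \<partial>A)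
      + ennreal (1 / t) * (\<integral>\<^sup>+a. supply_cost I x a \<partial>A) \<partial>measure_pmf p)"
  proof (rule nn_integral_mono_AE, rule AE_pmfI)
    fix x assume "x \<in> set_pmf p"
    then have x: "x \<le> units I" using p by auto
    have upd: "(\<lambda>(a, s). a(i := deviating_action I i t (x, s))) \<in> A \<Otimes>\<^sub>M unit_uniform \<rightarrow>\<^sub>M profile_space I {1..bidders I}"
    proof -
      have [measurable]: "(\<lambda>s. deviating_action I i t (x, s)) \<in> borel \<rightarrow>\<^sub>M action_space I"
        by (rule measurable_deviating_action_section[OF I i t'])
      have "fst \<in> A \<Otimes>\<^sub>M unit_uniform \<rightarrow>\<^sub>M profile_space I {1..bidders I}"
        "(\<lambda>z. deviating_action I i t (x, snd z)) \<in> A \<Otimes>\<^sub>M unit_uniform \<rightarrow>\<^sub>M action_space I"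
        by measurable
      from measurable_profile_update[OF this, of i] show ?thesis
        using i by (simp add: case_prod_beta' insert_absorb)
    qed
    have [measurable]: "(\<lambda>(a, s). ennreal (utility I i (a(i := deviating_action I i t (x, s)))))
        \<in> borel_measurable (A \<Otimes>\<^sub>M unit_uniform)"
      using measurable_compose[OF upd measurable_compose[OF measurable_utility[OF I i] measurable_ennreal]]
      by (simp add: case_prod_beta')
    have "ennreal ?l * ennreal (val I i x) = ennreal (?l * val I i x)"
      using t val[OF x] by (intro ennreal_mult[symmetric]) simp_all
    also have "\<dots> = (\<integral>\<^sup>+a. ennreal (?l * val I i x) \<partial>A)"
      by (simp add: A.emeasure_space_1)
    also have "\<dots> \<le> (\<integral>\<^sup>+a. (\<integral>\<^sup>+s. ennreal (utility I i (a(i := deviating_action I i t (x, s)))) \<partial>unit_uniform)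
        + ennreal (1 / t) * supply_cost I x a \<partial>A)"
      using deviation_guarantee[OF I i t _ x] by (intro nn_integral_mono) (simp add: space_A)
    also have "\<dots> = (\<integral>\<^sup>+a. \<integral>\<^sup>+s. ennreal (utility I i (a(i := deviating_action I i t (x, s)))) \<partial>unit_uniform \<partial>A)
        + ennreal (1 / t) * (\<integral>\<^sup>+a. supply_cost I x a \<partial>A)"
      by (simp add: nn_integral_add nn_integral_cmult)
    finally show "ennreal ?l * ennreal (val I i x) \<le> \<dots>" .
  qed
  also have "\<dots> = E + ennreal (1 / t) * (\<integral>\<^sup>+x. \<integral>\<^sup>+a. supply_cost I x a \<partial>A \<partial>measure_pmf p)"
    unfolding E_def int_M[OF measurable_compose[OF measurable_utility[OF I i] measurable_ennreal]]
    by (simp add: nn_integral_add nn_integral_cmult)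
  finally have "ennreal ?l * (\<integral>\<^sup>+x. ennreal (val I i x) \<partial>measure_pmf p)
      + (\<integral>\<^sup>+a. ennreal (payment I i a) \<partial>A)
    \<le> (E + (\<integral>\<^sup>+a. ennreal (payment I i a) \<partial>A))
      + ennreal (1 / t) * (\<integral>\<^sup>+x. \<integral>\<^sup>+a. supply_cost I x a \<partial>A \<partial>measure_pmf p)"
    by (simp add: add_ac add_left_mono add_right_mono)
  also have "\<dots> \<le> (\<integral>\<^sup>+a. ennreal (val I i (units_won I i a)) \<partial>A)
      + ennreal (1 / t) * (\<integral>\<^sup>+x. \<integral>\<^sup>+a. supply_cost I x a \<partial>A \<partial>measure_pmf p)"
    by (rule add_right_mono[OF E_pay])
  finally show ?thesis .
qed

lemma nn_integral_supply_cost_0: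
  assumes I: "discriminatory_auction I" and cce: "coarse_correlated_equilibrium I A"
  shows "(\<integral>\<^sup>+a. supply_cost I 0 a \<partial>A) = 0"
proof -
  have "(\<integral>\<^sup>+a. supply_cost I 0 a \<partial>A) = (\<integral>\<^sup>+a. 0 \<partial>A)"
    by (intro nn_integral_cong supply_cost_0 highest_bids_winners[OF I])
       (simp add: coarse_correlated_equilibriumD(4)[OF cce])
  then show ?thesis by simp
qed

text \<open>The second condition on \<open>t\<close> is
  \<open>(1 - exp (- t)) / t + 1 / t \<le> 1\<close> multiplied by \<open>t\<close>. If the
  equilibrium value exceeds the budget, the budget alone covers both terms on the left, whose
  weights sum to at most 1. Otherwise the minimum on the right is the value, and
  \<open>bidder_deviation_bound\<close> applies to a lottery whose expected value is the capped
  one.\<close>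

lemma bidder_liquid_bound:
  assumes I: "discriminatory_auction I" and cce: "coarse_correlated_equilibrium I A"
    and i: "i \<in> {1..bidders I}" and t: "0 < t" "2 - exp (- t) \<le> t"
    and p: "set_pmf p \<subseteq> {..units I}"
  shows "ennreal ((1 - exp (- t)) / t) * min (\<integral>\<^sup>+x. ennreal (val I i x) \<partial>measure_pmf p) (budget I i)
      + ennreal (1 / t) * (\<integral>\<^sup>+a. ennreal (payment I i a) \<partial>A)
    \<le> min (\<integral>\<^sup>+a. ennreal (val I i (units_won I i a)) \<partial>A) (budget I i)
      + ennreal (1 / t) * (\<integral>\<^sup>+x. \<integral>\<^sup>+a. supply_cost I x a \<partial>A \<partial>measure_pmf p)"
proof -
  let ?l = "(1 - exp (- t)) / t"
  let ?V = "\<lambda>p. \<integral>\<^sup>+x. ennreal (val I i x) \<partial>measure_pmf p"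
  let ?P = "\<integral>\<^sup>+a. ennreal (payment I i a) \<partial>A"
  let ?C = "\<lambda>p. \<integral>\<^sup>+x. \<integral>\<^sup>+a. supply_cost I x a \<partial>A \<partial>measure_pmf p"
  have l: "0 \<le> ?l" "?l + 1 / t \<le> 1" "0 \<le> 1 / t"
    using t by (simp_all add: field_simps)
  then have t_inv: "1 / t \<le> 1" by linarith
  show ?thesis
  proof (cases "(\<integral>\<^sup>+a. ennreal (val I i (units_won I i a)) \<partial>A) \<le> budget I i")
    case False
    have "ennreal ?l * min (?V p) (budget I i) + ennreal (1 / t) * ?P
        \<le> ennreal ?l * budget I i + ennreal (1 / t) * budget I i"
      using cce i by (intro add_mono mult_left_mono) (auto simp: coarse_correlated_equilibrium_def)
    also have "\<dots> = ennreal (?l + 1 / t) * budget I i"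
      using l by (simp only: ennreal_plus distrib_right)
    also have "\<dots> \<le> 1 * budget I i"
      using l(2) by (intro mult_right_mono) (simp_all add: ennreal_le_1)
    finally show ?thesis
      using False by (simp add: min_def add_increasing2)
  next
    case True
    \<comment> \<open>A lottery too expensive for the budget is mixed with the zero action until it is affordable.\<close>
    have "\<exists>q. set_pmf q \<subseteq> {..units I} \<and> ?V q = min (?V p) (budget I i) \<and> ?C q \<le> ?C p"
    proof (cases "?V p \<le> budget I i")
      case True
      then show ?thesis using p by (intro exI[of _ p]) simp
    next
      case exceeds: False
      have "?V p \<le> ennreal (Max (val I i ` {..units I}))"
      proof -
        have "?V p \<le> (\<integral>\<^sup>+x. ennreal (Max (val I i ` {..units I})) \<partial>measure_pmf p)"
          using p by (intro nn_integral_mono_AE AE_pmfI ennreal_leI val_le_Max) auto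
        then show ?thesis by (simp add: measure_pmf.emeasure_space_1)
      qed
      then have "?V p < \<infinity>"
        using le_less_trans ennreal_less_top by fastforce
      then obtain v where v: "?V p = ennreal v" "0 \<le> v"
        by (cases "?V p") auto
      obtain b where b: "budget I i = ennreal b" "0 \<le> b" "b < v"
        using exceeds v by (cases "budget I i") (auto simp: ennreal_le_iff not_le ennreal_less_iff)
      \<comment> \<open>This weight brings the expected value down to exactly the budget.\<close>
      define c where "c = b / v"
      have c: "0 \<le> c" "c \<le> 1" "c * v = b"
        using b by (simp_all add: c_def)
      define q where "q = bind_pmf (bernoulli_pmf c) (\<lambda>h. if h then p else return_pmf 0)"
      \<comment> \<open>Integrands vanishing at demand 0 are merely scaled, which covers both the
        value and the supply cost.\<close>
      have int_q: "(\<integral>\<^sup>+x. f x \<partial>measure_pmf q) = ennreal c * (\<integral>\<^sup>+x. f x \<partial>measure_pmf p)"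
        if "f 0 = 0" for f :: "nat \<Rightarrow> ennreal"
        unfolding q_def using c that by (simp add: mult.commute)
      have "(\<integral>\<^sup>+a. supply_cost I 0 a \<partial>A) = 0"
        by (rule nn_integral_supply_cost_0[OF I cce])
      then have "?C q = ennreal c * ?C p"
        by (intro int_q) simp
      also have "\<dots> \<le> 1 * ?C p"
        using c by (intro mult_right_mono) (simp_all add: ennreal_le_1)
      finally have "?C q \<le> ?C p" by simp
      moreover have "?V q = ennreal c * ?V p"
        using I i by (intro int_q) (simp add: discriminatory_auction_def)
      then have "?V q = min (?V p) (budget I i)"
        using c b v by (simp add: min_def ennreal_le_iff flip: ennreal_mult)
      moreover have "set_pmf q \<subseteq> {..units I}"
        using p by (auto simp: q_def split: if_splits)
      ultimately show ?thesis by blast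
    qed
    then obtain q where q: "set_pmf q \<subseteq> {..units I}" "?V q = min (?V p) (budget I i)" "?C q \<le> ?C p"
      by blast
    \<comment> \<open>The deviation bound holds even with the full payment on the left; the smaller
      weight \<open>1 / t\<close> is what matches the costs after summation.\<close>
    have "ennreal ?l * min (?V p) (budget I i) + ennreal (1 / t) * ?P \<le> ennreal ?l * ?V q + 1 * ?P"
      unfolding q(2) using t_inv by (intro add_left_mono mult_right_mono) (simp_all add: ennreal_le_1)
    also have "\<dots> \<le> (\<integral>\<^sup>+a. ennreal (val I i (units_won I i a)) \<partial>A) + ennreal (1 / t) * ?C q"
      using bidder_deviation_bound[OF I cce i t(1) q(1)] q(2) by simp
    also have "\<dots> \<le> (\<integral>\<^sup>+a. ennreal (val I i (units_won I i a)) \<partial>A) + ennreal (1 / t) * ?C p"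
      using q(3) by (intro add_left_mono mult_left_mono) simp_all
    finally show ?thesis
      using True by (simp add: min_def)
  qed
qed

text \<open>An infinite budget gives no bound on the payment. Demanding nothing is always feasible
  and has supply cost 0, so the payment is at most the value, which is bounded; the choice
  \<open>t = 1\<close> is arbitrary.\<close>

lemma finite_payment:
  assumes I: "discriminatory_auction I" and cce: "coarse_correlated_equilibrium I A"
    and i: "i \<in> {1..bidders I}"
  shows "(\<integral>\<^sup>+a. ennreal (payment I i a) \<partial>A) < \<infinity>"
proof -
  have "(\<integral>\<^sup>+a. ennreal (payment I i a) \<partial>A) \<le> (\<integral>\<^sup>+a. ennreal (val I i (units_won I i a)) \<partial>A)"
    using bidder_deviation_bound[OF I cce i zero_less_one, of "return_pmf 0"] I i
    by (simp add: discriminatory_auction_def nn_integral_supply_cost_0[OF I cce])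
  also have "\<dots> \<le> ennreal (Max (val I i ` {..units I}))"
    by (intro nn_integral_le_bound ennreal_leI val_le_Max coarse_correlated_equilibriumD(2)[OF cce]
        units_won_le_units[OF I]) (use i in \<open>simp_all add: coarse_correlated_equilibriumD(4)[OF cce]\<close>)
  finally show ?thesis
    using le_less_trans ennreal_less_top by fastforce
qed

section \<open>Summation over the bidders\<close>

text \<open>The factor increases with \<open>t\<close>, so the best choice is the smallest
  admissible \<open>t\<close>, where the second condition is an equality.\<close>

lemma optimal_liquid_welfare_le:
  assumes I: "discriminatory_auction I" and cce: "coarse_correlated_equilibrium I A"
    and t: "0 < t" "2 - exp (- t) \<le> t"
  shows "optimal_liquid_welfare I \<le> ennreal (t / (1 - exp (- t))) * liquid_welfare I A"
  unfolding optimal_liquid_welfare_def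
proof (rule SUP_least)
  let ?N = "{1..bidders I}"
  let ?l = "(1 - exp (- t)) / t"
  fix p :: "(nat \<Rightarrow> nat) pmf"
  assume "p \<in> {p. set_pmf p \<subseteq> feasible_allocations I}"
  then have p: "set_pmf p \<subseteq> feasible_allocations I" by simp
  let ?W = "\<Sum>i\<in>?N. min (\<integral>\<^sup>+x. ennreal (val I i (x i)) \<partial>measure_pmf p) (budget I i)"
  let ?P = "\<Sum>i\<in>?N. \<integral>\<^sup>+a. ennreal (payment I i a) \<partial>A"
  note [measurable_cong] = coarse_correlated_equilibriumD(3)[OF cce]
  note space_A = coarse_correlated_equilibriumD(4)[OF cce]
  note [measurable] = measurable_supply_cost[OF I]
  have pay: "(\<lambda>a. ennreal (payment I i a)) \<in> borel_measurable A" if "i \<in> ?N" for i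
    using measurable_payment[OF I that] by measurable
  \<comment> \<open>All demands come from one joint draw of an allocation, so together they never
    exceed the supply, as \<open>sum_supply_cost_le_payments\<close> requires.\<close>
  have cost: "(\<Sum>i\<in>?N. \<integral>\<^sup>+x. \<integral>\<^sup>+a. supply_cost I (x i) a \<partial>A \<partial>measure_pmf p) \<le> ?P"
  proof -
    have "(\<Sum>i\<in>?N. \<integral>\<^sup>+x. \<integral>\<^sup>+a. supply_cost I (x i) a \<partial>A \<partial>measure_pmf p)
        = (\<integral>\<^sup>+x. \<integral>\<^sup>+a. (\<Sum>i\<in>?N. supply_cost I (x i) a) \<partial>A \<partial>measure_pmf p)"
      by (simp add: nn_integral_sum)
    also have "\<dots> \<le> (\<integral>\<^sup>+x. ?P \<partial>measure_pmf p)"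
    proof (rule nn_integral_mono_AE, rule AE_pmfI)
      fix x assume "x \<in> set_pmf p"
      then have "(\<Sum>i\<in>?N. x i) \<le> units I"
        using p by (auto simp: feasible_allocations_def)
      then have "(\<integral>\<^sup>+a. (\<Sum>i\<in>?N. supply_cost I (x i) a) \<partial>A) \<le> (\<integral>\<^sup>+a. (\<Sum>i\<in>?N. ennreal (payment I i a)) \<partial>A)"
        by (intro nn_integral_mono sum_supply_cost_le_payments[OF I]) (simp_all add: space_A)
      also have "\<dots> = ?P"
        by (rule nn_integral_sum[OF pay])
      finally show "(\<integral>\<^sup>+a. (\<Sum>i\<in>?N. supply_cost I (x i) a) \<partial>A) \<le> ?P" .
    qed
    finally show ?thesis
      by (simp add: measure_pmf.emeasure_space_1)
  qed
  have "ennreal ?l * ?W + ennreal (1 / t) * ?P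
      = (\<Sum>i\<in>?N. ennreal ?l * min (\<integral>\<^sup>+x. ennreal (val I i (x i)) \<partial>measure_pmf p) (budget I i)
        + ennreal (1 / t) * (\<integral>\<^sup>+a. ennreal (payment I i a) \<partial>A))"
    by (simp only: sum.distrib sum_distrib_left)
  also have "\<dots> \<le> (\<Sum>i\<in>?N. min (\<integral>\<^sup>+a. ennreal (val I i (units_won I i a)) \<partial>A) (budget I i)
      + ennreal (1 / t) * (\<integral>\<^sup>+x. \<integral>\<^sup>+a. supply_cost I (x i) a \<partial>A \<partial>measure_pmf p))"
  proof (rule sum_mono)
    fix i assume i: "i \<in> ?N"
    \<comment> \<open>Each bidder deviates with her own marginal of the lottery; only
      \<open>cost\<close> depends on the joint law.\<close>
    have "set_pmf (map_pmf (\<lambda>x. x i) p) \<subseteq> {..units I}"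
      using p i by (fastforce simp: feasible_allocations_def PiE_iff)
    from bidder_liquid_bound[OF I cce i t this]
    show "ennreal ?l * min (\<integral>\<^sup>+x. ennreal (val I i (x i)) \<partial>measure_pmf p) (budget I i)
        + ennreal (1 / t) * (\<integral>\<^sup>+a. ennreal (payment I i a) \<partial>A)
      \<le> min (\<integral>\<^sup>+a. ennreal (val I i (units_won I i a)) \<partial>A) (budget I i)
        + ennreal (1 / t) * (\<integral>\<^sup>+x. \<integral>\<^sup>+a. supply_cost I (x i) a \<partial>A \<partial>measure_pmf p)"
      by simp
  qed
  also have "\<dots> = liquid_welfare I A
      + ennreal (1 / t) * (\<Sum>i\<in>?N. \<integral>\<^sup>+x. \<integral>\<^sup>+a. supply_cost I (x i) a \<partial>A \<partial>measure_pmf p)"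
    by (simp only: sum.distrib sum_distrib_left liquid_welfare_def)
  also have "\<dots> \<le> liquid_welfare I A + ennreal (1 / t) * ?P"
    by (intro add_left_mono mult_left_mono cost) simp
  finally have "ennreal (1 / t) * ?P + ennreal ?l * ?W \<le> ennreal (1 / t) * ?P + liquid_welfare I A"
    by (simp only: add.commute)
  \<comment> \<open>Cancelling the payments in \<open>ennreal\<close> needs their sum to be
    finite.\<close>
  moreover have "?P < \<infinity>"
    using finite_payment[OF I cce] by simp
  then have "ennreal (1 / t) * ?P < \<infinity>"
    by (simp add: ennreal_mult_less_top)
  ultimately have lW: "ennreal ?l * ?W \<le> liquid_welfare I A"
    by (auto simp: ennreal_add_left_cancel_le)
  have "?W = ennreal (t / (1 - exp (- t))) * (ennreal ?l * ?W)"
    using t(1) by (simp flip: mult.assoc ennreal_mult)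
  also have "\<dots> \<le> ennreal (t / (1 - exp (- t))) * liquid_welfare I A"
    by (intro mult_left_mono lW) simp
  finally show "?W \<le> ennreal (t / (1 - exp (- t))) * liquid_welfare I A" .
qed

theorem theorem5p1:
  shows "price_of_anarchy
           \<le> ennreal ((2 + lambert_W0 (- exp (- 2))) / (1 + lambert_W0 (- exp (- 2))))
    \<and> (\<forall>(I :: auction) (A :: profile measure).
         discriminatory_auction I \<longrightarrow> coarse_correlated_equilibrium I A \<longrightarrow>
           optimal_liquid_welfare I
             \<le> ennreal ((2 + lambert_W0 (- exp (- 2))) / (1 + lambert_W0 (- exp (- 2))))
               * liquid_welfare I A)"
proof -
  define w where "w = lambert_W0 (- exp (- 2))"
  have w: "- 1 \<le> w" "w * exp w = - exp (- 2)"
    using lambert_W0_minus_exp_minus_2 by (simp_all add: w_def)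
  \<comment> \<open>With \<open>t = 2 + w\<close> this makes \<open>2 - exp (- t) \<le> t\<close> an
    equality and turns \<open>t / (1 - exp (- t))\<close> into
    \<open>(2 + w) / (1 + w)\<close>.\<close>
  have exp_w: "exp (- (2 + w)) = - w"
  proof -
    have "exp (- (2 + w)) = exp (- 2) * exp (- w)"
      by (simp flip: exp_add)
    also have "\<dots> = - (w * exp w) * exp (- w)"
      by (simp only: w(2) minus_minus)
    also have "\<dots> = - w"
      by (simp add: exp_minus)
    finally show ?thesis .
  qed
  have bound: "optimal_liquid_welfare I \<le> ennreal ((2 + w) / (1 + w)) * liquid_welfare I A"
    if "discriminatory_auction I" "coarse_correlated_equilibrium I A" for I A
    using optimal_liquid_welfare_le[OF that, of "2 + w"] w(1) unfolding exp_w by simp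
  have "optimal_liquid_welfare I / liquid_welfare I A \<le> ennreal ((2 + w) / (1 + w))"
    if "discriminatory_auction I" "coarse_correlated_equilibrium I A" for I A
  \<comment> \<open>In the zero case \<open>bound\<close> forces the optimum to be 0, and
    \<open>0 / 0 = 0\<close> in \<open>ennreal\<close>.\<close>
  proof (cases "liquid_welfare I A = 0")
    case True
    then show ?thesis using bound[OF that] by simp
  next
    case False
    then show ?thesis
      using bound[OF that] by (intro divide_le_posI_ennreal) (simp_all add: mult.commute zero_less_iff_neq_zero)
  qed
  then have "price_of_anarchy \<le> ennreal ((2 + w) / (1 + w))"
    unfolding price_of_anarchy_def by (intro SUP_least) auto
  with bound show ?thesis
    unfolding w_def by blast
qed

end
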